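(* Every coadjoint orbit of $SL(2,\mathbb R)$ in $\mathfrak g^*=sl(2,\mathbb R)^*$ is of one of the following forms (with $x,h,y\in\mathbb R$ and $\lambda$ a nonzero real number): (a) Elliptic hyperboloid: $\Omega^1_\lambda=\{2xX^*+2hH^*-2yY^* \mid x^2+h^2=y^2+\lambda^2\}$, $\lambda\neq 0$. (b) Upper half-cone: $\Omega^2_+=\{2xX^*+2hH^*-2yY^* \mid x^2+h^2=y^2,\ y>0\}$; lower half-cone: $\Omega^2_-=\{2xX^*+2hH^*-2yY^* \mid x^2+h^2=y^2,\ y<0\}$; one point: $\Omega^2_0=\{0\}$. (c) Upper half-hyperboloid: $\Omega^3_{\lambda,+}=\{2xX^*+2hH^*-2yY^* \mid x^2+h^2=y^2-\lambda^2,\ y>0\}$, $\lambda\ne 0$; lower half-hyperboloid: $\Omega^3_{\lambda,-}=\{2xX^*+2hH^*-2yY^* \mid x^2+h^2=y^2-\lambda^2,\ y<0\}$, $\lambda\neq 0$.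
   Context: $\mathfrak g=sl(2,\mathbb R)$ is the Lie algebra of real $2\times 2$ traceless matrices, with basis $H=\begin{pmatrix}1&0\\0&-1\end{pmatrix}$, $X=\begin{pmatrix}0&1\\1&0\end{pmatrix}$, $Y=\begin{pmatrix}0&1\\-1&0\end{pmatrix}$, so $[H,X]=2Y$, $[H,Y]=2X$, $[X,Y]=-2H$. $X^*,H^*,Y^*$ is the dual basis of $\mathfrak g^*$. The coadjoint action of $G=SL(2,\mathbb R)$ on $\mathfrak g^*$ is $\langle K(g)F,Z\rangle=\langle F,\mathrm{Ad}(g^{-1})Z\rangle$ for $F\in\mathfrak g^*$, $g\in G$, $Z\in\mathfrak g$; coadjoint orbits are the orbits of this action. *)

theory Defs
  imports "HOL-Analysis.Analysis" "HOL-Algebra.Group_Action"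
begin

section \<open>The group and its Lie algebra\<close>

definition SL2 :: "(real^2^2) monoid"
  where "SL2 = \<lparr>carrier = {g. det g = 1}, mult = (**), one = mat 1\<rparr>"

typedef sl2 = "{A :: real^2^2. trace A = 0}"
  morphisms mat_of_sl2 Abs_sl2
  by (rule exI[of _ 0]) (simp add: trace_def)

instantiation sl2 :: real_vector
begin

definition zero_sl2 :: sl2
  where "zero_sl2 = Abs_sl2 0"

definition plus_sl2 :: "sl2 \<Rightarrow> sl2 \<Rightarrow> sl2"
  where "plus_sl2 A B = Abs_sl2 (mat_of_sl2 A + mat_of_sl2 B)"

definition minus_sl2 :: "sl2 \<Rightarrow> sl2 \<Rightarrow> sl2"
  where "minus_sl2 A B = Abs_sl2 (mat_of_sl2 A - mat_of_sl2 B)"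

definition uminus_sl2 :: "sl2 \<Rightarrow> sl2"
  where "uminus_sl2 A = Abs_sl2 (- mat_of_sl2 A)"

definition scaleR_sl2 :: "real \<Rightarrow> sl2 \<Rightarrow> sl2"
  where "scaleR_sl2 c A = Abs_sl2 (c *\<^sub>R mat_of_sl2 A)"

lemma trace_mat_of_sl2: "trace (mat_of_sl2 A) = 0"
  using mat_of_sl2 by simp

lemma mat_of_Abs_sl2: "trace A = 0 \<Longrightarrow> mat_of_sl2 (Abs_sl2 A) = A"
  by (simp add: Abs_sl2_inverse)

lemma mat_of_sl2_arith [simp]:
  "mat_of_sl2 0 = 0"
  "mat_of_sl2 (A + B) = mat_of_sl2 A + mat_of_sl2 B"
  "mat_of_sl2 (A - B) = mat_of_sl2 A - mat_of_sl2 B"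
  "mat_of_sl2 (- A) = - mat_of_sl2 A"
  "mat_of_sl2 (c *\<^sub>R A) = c *\<^sub>R mat_of_sl2 A"
  using trace_mat_of_sl2[of A] trace_mat_of_sl2[of B]
  by (simp_all add: zero_sl2_def plus_sl2_def minus_sl2_def uminus_sl2_def scaleR_sl2_def
      mat_of_Abs_sl2 trace_def sum.distrib sum_subtractf sum_negf flip: sum_distrib_left)

instance
  by standard (simp_all add: mat_of_sl2_inject[symmetric] algebra_simps)

end

definition H_sl2 :: sl2
  where "H_sl2 = Abs_sl2 (vector [vector [1, 0], vector [0, - 1]])"

definition X_sl2 :: sl2
  where "X_sl2 = Abs_sl2 (vector [vector [0, 1], vector [1, 0]])"

definition Y_sl2 :: sl2
  where "Y_sl2 = Abs_sl2 (vector [vector [0, 1], vector [- 1, 0]])"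

lemma mat_of_basis [simp]:
  "mat_of_sl2 H_sl2 = vector [vector [1, 0], vector [0, - 1]]"
  "mat_of_sl2 X_sl2 = vector [vector [0, 1], vector [1, 0]]"
  "mat_of_sl2 Y_sl2 = vector [vector [0, 1], vector [- 1, 0]]"
  by (simp_all add: H_sl2_def X_sl2_def Y_sl2_def mat_of_Abs_sl2 trace_def sum_2)

lemma sl2_eq_iff:
  "A = B \<longleftrightarrow> mat_of_sl2 A $ 1 $ 1 = mat_of_sl2 B $ 1 $ 1
     \<and> mat_of_sl2 A $ 1 $ 2 = mat_of_sl2 B $ 1 $ 2
     \<and> mat_of_sl2 A $ 2 $ 1 = mat_of_sl2 B $ 2 $ 1"
  using trace_mat_of_sl2[of A] trace_mat_of_sl2[of B]
  by (auto simp: mat_of_sl2_inject[symmetric] vec_eq_iff forall_2 trace_def sum_2)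

lemma sl2_expansion:
  "Z = mat_of_sl2 Z $ 1 $ 1 *\<^sub>R H_sl2
     + ((mat_of_sl2 Z $ 1 $ 2 + mat_of_sl2 Z $ 2 $ 1) / 2) *\<^sub>R X_sl2
     + ((mat_of_sl2 Z $ 1 $ 2 - mat_of_sl2 Z $ 2 $ 1) / 2) *\<^sub>R Y_sl2"
  by (simp add: sl2_eq_iff field_simps)

lemma sl2_basis_distinct: "H_sl2 \<noteq> X_sl2" "H_sl2 \<noteq> Y_sl2" "X_sl2 \<noteq> Y_sl2"
  by (simp_all add: sl2_eq_iff)

lemma independent_sl2_basis: "independent {H_sl2, X_sl2, Y_sl2}"
proof (rule independent_if_scalars_zero)
  fix f x
  assume "(\<Sum>x\<in>{H_sl2, X_sl2, Y_sl2}. f x *\<^sub>R x) = 0" and x: "x \<in> {H_sl2, X_sl2, Y_sl2}"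
  then have "f H_sl2 *\<^sub>R H_sl2 + (f X_sl2 *\<^sub>R X_sl2 + f Y_sl2 *\<^sub>R Y_sl2) = 0"
    using sl2_basis_distinct by simp
  then have "f H_sl2 = 0 \<and> f X_sl2 = 0 \<and> f Y_sl2 = 0"
    by (auto simp: sl2_eq_iff)
  then show "f x = 0"
    using x by blast
qed simp

lemma span_sl2_basis: "span {H_sl2, X_sl2, Y_sl2} = UNIV"
proof -
  have "Z \<in> span {H_sl2, X_sl2, Y_sl2}" for Z
    by (subst sl2_expansion[of Z]) (intro span_add span_scale span_base; simp)
  then show ?thesis
    by blast
qed


section \<open>The dual space and its dual basis\<close>

definition sl2_dual :: "(sl2 \<Rightarrow> real) set"
  where "sl2_dual = {F. linear F}"

text \<open>The coefficient of \<open>B\<close> in the expansion of \<open>Z\<close> in the basis \<open>H, X, Y\<close>.\<close>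

definition dual_vec :: "sl2 \<Rightarrow> sl2 \<Rightarrow> real"
  where "dual_vec B Z = representation {H_sl2, X_sl2, Y_sl2} Z B"

abbreviation "H_star \<equiv> dual_vec H_sl2"
abbreviation "X_star \<equiv> dual_vec X_sl2"
abbreviation "Y_star \<equiv> dual_vec Y_sl2"

lemma dual_vec_in_dual: "dual_vec B \<in> sl2_dual"
  unfolding sl2_dual_def dual_vec_def
  by (auto intro!: linearI
      simp: representation_add[OF independent_sl2_basis]
        representation_scale[OF independent_sl2_basis] span_sl2_basis)

lemma dual_vec_basis:
  assumes "B \<in> {H_sl2, X_sl2, Y_sl2}" "C \<in> {H_sl2, X_sl2, Y_sl2}"
  shows "dual_vec B C = (if B = C then 1 else 0)"
  unfolding dual_vec_def
  using assms by (auto simp: representation_basis[OF independent_sl2_basis])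

lemma dual_vec_entries:
  "H_star Z = mat_of_sl2 Z $ 1 $ 1"
  "X_star Z = (mat_of_sl2 Z $ 1 $ 2 + mat_of_sl2 Z $ 2 $ 1) / 2"
  "Y_star Z = (mat_of_sl2 Z $ 1 $ 2 - mat_of_sl2 Z $ 2 $ 1) / 2"
proof -
  have lin: "linear (dual_vec B)" for B
    using dual_vec_in_dual by (simp add: sl2_dual_def)
  show
    "H_star Z = mat_of_sl2 Z $ 1 $ 1"
    "X_star Z = (mat_of_sl2 Z $ 1 $ 2 + mat_of_sl2 Z $ 2 $ 1) / 2"
    "Y_star Z = (mat_of_sl2 Z $ 1 $ 2 - mat_of_sl2 Z $ 2 $ 1) / 2"
    using sl2_basis_distinct
    by (subst sl2_expansion[of Z],
        simp add: linear_add[OF lin] linear_scale[OF lin] dual_vec_basis)+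
qed


section \<open>The coadjoint action\<close>

definition Ad :: "real^2^2 \<Rightarrow> sl2 \<Rightarrow> sl2"
  where "Ad g Z = Abs_sl2 (g ** mat_of_sl2 Z ** matrix_inv g)"

text \<open>The action is restricted to the linear functionals, as the library's locale for group actions
  requires extensional bijections of the carrier.\<close>

definition coad :: "real^2^2 \<Rightarrow> (sl2 \<Rightarrow> real) \<Rightarrow> (sl2 \<Rightarrow> real)"
  where "coad g = (\<lambda>F\<in>sl2_dual. \<lambda>Z. F (Ad (inv\<^bsub>SL2\<^esub> g) Z))"

definition coadjoint_orbits :: "(sl2 \<Rightarrow> real) set set"
  where "coadjoint_orbits = orbits SL2 sl2_dual coad"

lemma group_SL2: "group SL2"
proof (rule groupI)
  fix g assume "g \<in> carrier SL2"
  then have d: "det g = 1"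
    by (simp add: SL2_def)
  then have "invertible g"
    by (simp add: invertible_det_nz)
  then obtain h where h: "h ** g = mat 1" "g ** h = mat 1"
    unfolding invertible_def by blast
  then have "det h = 1"
    using d by (metis det_I det_mul mult.right_neutral)
  then show "\<exists>h\<in>carrier SL2. h \<otimes>\<^bsub>SL2\<^esub> g = \<one>\<^bsub>SL2\<^esub>"
    using h by (auto simp: SL2_def)
qed (auto simp: SL2_def det_mul det_I matrix_mul_assoc)

lemma matrix_inv_eqI:
  fixes g h :: "real^2^2"
  assumes "g ** h = mat 1"
  shows "matrix_inv g = h"
proof -
  have hg: "h ** g = mat 1"
    using assms matrix_left_right_inverse by blast
  have "g ** matrix_inv g = mat 1 \<and> matrix_inv g ** g = mat 1"
    unfolding matrix_inv_def by (rule someI[of _ h]) (simp add: assms hg)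
  then show ?thesis
    by (metis assms matrix_mul_assoc matrix_mul_lid matrix_mul_rid)
qed

lemma SL2_inv: "g \<in> carrier SL2 \<Longrightarrow> inv\<^bsub>SL2\<^esub> g = matrix_inv g"
  using group.r_inv[OF group_SL2, of g] by (simp add: SL2_def matrix_inv_eqI)

lemma SL2_matrix_inv:
  assumes "g \<in> carrier SL2"
  shows "g ** matrix_inv g = mat 1" "matrix_inv g ** g = mat 1"
  using group.r_inv[OF group_SL2 assms] group.l_inv[OF group_SL2 assms] SL2_inv[OF assms]
  by (simp_all add: SL2_def)

lemma mat_of_Ad:
  assumes "g \<in> carrier SL2"
  shows "mat_of_sl2 (Ad g Z) = g ** mat_of_sl2 Z ** matrix_inv g"
proof -
  have "trace (g ** mat_of_sl2 Z ** matrix_inv g) = trace (matrix_inv g ** (g ** mat_of_sl2 Z))"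
    by (rule trace_mul_sym)
  also have "\<dots> = 0"
    by (simp add: matrix_mul_assoc SL2_matrix_inv[OF assms] trace_mat_of_sl2)
  finally show ?thesis
    by (simp add: Ad_def mat_of_Abs_sl2)
qed

lemma linear_Ad: "g \<in> carrier SL2 \<Longrightarrow> linear (Ad g)"
  by (rule linearI; simp add: sl2_eq_iff mat_of_Ad matrix_matrix_mult_def sum_2 algebra_simps)

lemma Ad_one: "Ad (\<one>\<^bsub>SL2\<^esub>) Z = Z"
proof -
  have "\<one>\<^bsub>SL2\<^esub> \<in> carrier SL2"
    using group_SL2 group.is_monoid monoid.one_closed by blast
  from mat_of_Ad[OF this] show ?thesis
    by (simp add: mat_of_sl2_inject[symmetric] SL2_def matrix_inv_eqI)
qed

lemma Ad_mult:
  assumes "g \<in> carrier SL2" "h \<in> carrier SL2"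
  shows "Ad (g \<otimes>\<^bsub>SL2\<^esub> h) Z = Ad g (Ad h Z)"
proof -
  have gh: "g \<otimes>\<^bsub>SL2\<^esub> h \<in> carrier SL2"
    using assms group_SL2 by (simp add: group.is_monoid monoid.m_closed)
  have "inv\<^bsub>SL2\<^esub> (g \<otimes>\<^bsub>SL2\<^esub> h) = inv\<^bsub>SL2\<^esub> h \<otimes>\<^bsub>SL2\<^esub> inv\<^bsub>SL2\<^esub> g"
    using assms group_SL2 by (simp add: group.inv_mult_group)
  then have "matrix_inv (g ** h) = matrix_inv h ** matrix_inv g"
    using assms gh SL2_inv by (simp add: SL2_def)
  then show ?thesis
    using mat_of_Ad[OF gh] assms
    by (simp add: mat_of_sl2_inject[symmetric] mat_of_Ad matrix_mul_assoc)
      (simp add: SL2_def matrix_mul_assoc)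
qed

lemma coad_closed:
  assumes "g \<in> carrier SL2" "F \<in> sl2_dual"
  shows "coad g F \<in> sl2_dual"
  using assms linear_compose[OF linear_Ad, of "inv\<^bsub>SL2\<^esub> g" F]
  by (simp add: coad_def sl2_dual_def o_def group.inv_closed[OF group_SL2])

lemma coad_one: "F \<in> sl2_dual \<Longrightarrow> coad (\<one>\<^bsub>SL2\<^esub>) F = F"
  using group_SL2 by (simp add: coad_def Ad_one monoid.inv_one group.is_monoid)

lemma coad_mult:
  assumes "g \<in> carrier SL2" "h \<in> carrier SL2" "F \<in> sl2_dual"
  shows "coad (g \<otimes>\<^bsub>SL2\<^esub> h) F = coad g (coad h F)"
  using assms coad_closed[OF assms(2,3)] group_SL2
  by (simp add: coad_def group.inv_mult_group Ad_mult group.inv_closed)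

lemma group_action_coad: "group_action SL2 sl2_dual coad"
proof -
  interpret G: group SL2
    by (rule group_SL2)
  have inv_l: "coad (inv\<^bsub>SL2\<^esub> g) (coad g F) = F"
    and inv_r: "coad g (coad (inv\<^bsub>SL2\<^esub> g) F) = F"
    if "g \<in> carrier SL2" "F \<in> sl2_dual" for g F
    using that by (simp_all flip: coad_mult add: coad_one)
  have bij: "coad g \<in> Bij sl2_dual" if "g \<in> carrier SL2" for g
    unfolding Bij_def
    using that by (auto intro!: bij_betw_byWitness[where f' = "coad (inv\<^bsub>SL2\<^esub> g)"]
        simp: inv_l inv_r coad_closed) (simp add: coad_def)
  have "coad (g \<otimes>\<^bsub>SL2\<^esub> h) = compose sl2_dual (coad g) (coad h)"
    if "g \<in> carrier SL2" "h \<in> carrier SL2" for g h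
  proof
    fix F
    show "coad (g \<otimes>\<^bsub>SL2\<^esub> h) F = compose sl2_dual (coad g) (coad h) F"
    proof (cases "F \<in> sl2_dual")
      case True
      then show ?thesis
        using that by (simp add: coad_mult compose_def)
    next
      case False
      then show ?thesis
        by (simp add: coad_def compose_def)
    qed
  qed
  then have "coad \<in> hom SL2 (BijGroup sl2_dual)"
    using bij by (auto simp: hom_def BijGroup_def)
  then show ?thesis
    unfolding group_action_def group_hom_def group_hom_axioms_def
    using group_SL2 group_BijGroup by blast
qed


section \<open>The model sets\<close>

definition dual_point :: "real \<Rightarrow> real \<Rightarrow> real \<Rightarrow> sl2 \<Rightarrow> real"
  where "dual_point x h y = (\<lambda>Z. 2 * x * X_star Z + 2 * h * H_star Z - 2 * y * Y_star Z)"

definition Omega1 :: "real \<Rightarrow> (sl2 \<Rightarrow> real) set"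
  where "Omega1 l = {dual_point x h y | x h y. x\<^sup>2 + h\<^sup>2 = y\<^sup>2 + l\<^sup>2}"

definition Omega2_upper :: "(sl2 \<Rightarrow> real) set"
  where "Omega2_upper = {dual_point x h y | x h y. x\<^sup>2 + h\<^sup>2 = y\<^sup>2 \<and> y > 0}"

definition Omega2_lower :: "(sl2 \<Rightarrow> real) set"
  where "Omega2_lower = {dual_point x h y | x h y. x\<^sup>2 + h\<^sup>2 = y\<^sup>2 \<and> y < 0}"

definition Omega2_zero :: "(sl2 \<Rightarrow> real) set"
  where "Omega2_zero = {\<lambda>Z. 0}"

definition Omega3_upper :: "real \<Rightarrow> (sl2 \<Rightarrow> real) set"
  where "Omega3_upper l = {dual_point x h y | x h y. x\<^sup>2 + h\<^sup>2 = y\<^sup>2 - l\<^sup>2 \<and> y > 0}"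

definition Omega3_lower :: "real \<Rightarrow> (sl2 \<Rightarrow> real) set"
  where "Omega3_lower l = {dual_point x h y | x h y. x\<^sup>2 + h\<^sup>2 = y\<^sup>2 - l\<^sup>2 \<and> y < 0}"

end

theory Submission
  imports Defs
begin

text \<open>
  The trace form \<open>(A, Z) \<mapsto> tr (A Z)\<close> identifies \<open>sl2\<close> with its dual and turns the coadjoint action
  into conjugation (\<open>coad_trace_dual\<close>). Since \<open>dual_point x h y\<close> corresponds to \<open>A = x X + h H + y Y\<close>,
  with \<open>det A = y\<^sup>2 - x\<^sup>2 - h\<^sup>2\<close>, the theorem is the classification of traceless real matrices up to
  conjugation by \<open>SL(2, \<real>)\<close>; conjugation by \<open>GL(2, \<real>)\<close> sees only the determinant (apart from the
  zero matrix), and what remains to be found is a sign.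

  The sign is carried by the binary quadratic form \<open>q(v) = v \<and> A v\<close>, the determinant of the matrix
  with columns \<open>v\<close> and \<open>A v\<close>. It is an invariant of the pair \<open>(A, v)\<close> under \<open>SL(2, \<real>)\<close>. By
  Cayley--Hamilton \<open>A\<^sup>2 = - det A\<close>, so if \<open>q(v) = s\<close> with \<open>s = \<plusminus>1\<close>, then in the unimodular basis
  \<open>v, s A v\<close> the matrix \<open>A\<close> takes a normal form that depends only on \<open>s\<close> and \<open>det A\<close>. Hence two
  matrices of equal determinant are conjugate as soon as their forms take values of a common sign
  (\<open>SL2_conjugate_if_same_sign\<close>). The form has discriminant a negative multiple of \<open>det A\<close>, which
  gives the three types of orbits:
  if \<open>det A < 0\<close>, then \<open>q\<close> is indefinite, and the orbit is the whole level set of the determinant;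
  if \<open>det A \<ge> 0\<close> and \<open>y \<noteq> 0\<close>, then \<open>q\<close> is nonzero and semidefinite, of the sign of its trace
  \<open>-2 y\<close>, so the sign of \<open>y\<close> is invariant, and the orbit is the half of the level set with that sign;
  if \<open>det A \<ge> 0\<close> and \<open>y = 0\<close>, then \<open>x\<^sup>2 + h\<^sup>2 \<le> 0\<close>, so \<open>A = 0\<close>.
\<close>

section \<open>The trace form\<close>

definition trace_dual :: "sl2 \<Rightarrow> sl2 \<Rightarrow> real"
  where "trace_dual A Z = trace (mat_of_sl2 A ** mat_of_sl2 Z)"

definition sl2_point :: "real \<Rightarrow> real \<Rightarrow> real \<Rightarrow> sl2"
  where "sl2_point x h y = x *\<^sub>R X_sl2 + h *\<^sub>R H_sl2 + y *\<^sub>R Y_sl2"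

abbreviation sl2_det :: "sl2 \<Rightarrow> real"
  where "sl2_det A \<equiv> det (mat_of_sl2 A)"

definition Y_coord :: "sl2 \<Rightarrow> real"
  where "Y_coord A = (mat_of_sl2 A $ 1 $ 2 - mat_of_sl2 A $ 2 $ 1) / 2"

lemma mat_of_sl2_22: "mat_of_sl2 A $ 2 $ 2 = - mat_of_sl2 A $ 1 $ 1"
  using trace_mat_of_sl2[of A] by (simp add: trace_def sum_2)

lemma sl2_det_entries:
  "sl2_det A = - (mat_of_sl2 A $ 1 $ 1)\<^sup>2 - mat_of_sl2 A $ 1 $ 2 * mat_of_sl2 A $ 2 $ 1"
  by (simp add: det_2 mat_of_sl2_22 power2_eq_square)

lemma trace_dual_sl2_point: "trace_dual (sl2_point x h y) = dual_point x h y"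
  by (rule ext)
    (simp add: trace_dual_def sl2_point_def dual_point_def dual_vec_entries trace_def
      matrix_matrix_mult_def sum_2 mat_of_sl2_22 field_simps)

lemma sl2_det_sl2_point: "sl2_det (sl2_point x h y) = y\<^sup>2 - x\<^sup>2 - h\<^sup>2"
  unfolding sl2_det_entries by (simp add: sl2_point_def power2_eq_square algebra_simps)

lemma Y_coord_sl2_point: "Y_coord (sl2_point x h y) = y"
  by (simp add: Y_coord_def sl2_point_def)

lemma sl2_point_cases: obtains x h y where "A = sl2_point x h y"
  using sl2_expansion[of A] unfolding sl2_point_def by (metis add.commute)

lemma trace_dual_surj:
  assumes "F \<in> sl2_dual"
  obtains A where "F = trace_dual A"
proof
  have lin: "linear F"
    using assms by (simp add: sl2_dual_def)
  have "F Z = dual_point (F X_sl2 / 2) (F H_sl2 / 2) (- F Y_sl2 / 2) Z" for Z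
    by (subst sl2_expansion[of Z])
      (simp add: linear_add[OF lin] linear_scale[OF lin] dual_point_def dual_vec_entries
        mult.commute)
  then show "F = trace_dual (sl2_point (F X_sl2 / 2) (F H_sl2 / 2) (- F Y_sl2 / 2))"
    unfolding trace_dual_sl2_point by (rule ext)
qed

lemma trace_dual_in_dual: "trace_dual A \<in> sl2_dual"
  unfolding sl2_dual_def
  by (auto intro!: linearI simp: trace_dual_def trace_def matrix_matrix_mult_def sum_2 algebra_simps)

text \<open>Cyclicity of the trace: \<open>tr (A g\<inverse> Z g) = tr (g A g\<inverse> Z)\<close>.\<close>

lemma coad_trace_dual:
  assumes g: "g \<in> carrier SL2"
  shows "coad g (trace_dual A) = trace_dual (Ad g A)"
proof
  fix Z
  let ?a = "mat_of_sl2 A" and ?z = "mat_of_sl2 Z"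
  have gi: "matrix_inv g \<in> carrier SL2"
    using group.inv_closed[OF group_SL2 g] SL2_inv[OF g] by simp
  have "coad g (trace_dual A) Z = trace (?a ** (matrix_inv g ** ?z ** matrix_inv (matrix_inv g)))"
    using g gi by (simp add: coad_def trace_dual_in_dual trace_dual_def SL2_inv mat_of_Ad)
  also have "\<dots> = trace ((?a ** matrix_inv g ** ?z) ** g)"
    using SL2_matrix_inv(2)[OF g] by (simp add: matrix_inv_eqI matrix_mul_assoc)
  also have "\<dots> = trace (g ** (?a ** matrix_inv g ** ?z))"
    by (rule trace_mul_sym)
  also have "\<dots> = trace_dual (Ad g A) Z"
    using g by (simp add: trace_dual_def mat_of_Ad matrix_mul_assoc)
  finally show "coad g (trace_dual A) Z = trace_dual (Ad g A) Z" .
qed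

definition Ad_orbit :: "sl2 \<Rightarrow> sl2 set"
  where "Ad_orbit A = {Ad g A | g. g \<in> carrier SL2}"

lemma coadjoint_orbit_eq_image:
  assumes "\<Omega> \<in> coadjoint_orbits"
  obtains A where "\<Omega> = trace_dual ` Ad_orbit A"
proof -
  obtain F where F: "F \<in> sl2_dual" "\<Omega> = orbit SL2 coad F"
    using assms unfolding coadjoint_orbits_def orbits_def by blast
  obtain A where "F = trace_dual A"
    using F(1) by (rule trace_dual_surj)
  then have "\<Omega> = trace_dual ` Ad_orbit A"
    using F(2) unfolding orbit_def Ad_orbit_def setcompr_eq_image image_image
    by (simp add: coad_trace_dual)
  then show thesis
    by (rule that)
qed

lemma dual_point_set_eq_image:
  assumes "\<And>x h y. P x h y \<longleftrightarrow> Q (sl2_point x h y)"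
  shows "{dual_point x h y | x h y. P x h y} = trace_dual ` {A. Q A}"
proof -
  have "{A. Q A} = {sl2_point x h y | x h y. P x h y}" (is "?L = ?R")
  proof (intro subset_antisym subsetI)
    fix A assume "A \<in> ?L"
    obtain x h y where A: "A = sl2_point x h y"
      by (rule sl2_point_cases)
    with \<open>A \<in> ?L\<close> have "P x h y"
      unfolding assms by blast
    with A show "A \<in> ?R"
      by blast
  next
    fix A assume "A \<in> ?R"
    then show "A \<in> ?L"
      unfolding assms by blast
  qed
  then have "trace_dual ` {A. Q A} = trace_dual ` {sl2_point x h y | x h y. P x h y}"
    by (rule arg_cong)
  also have "\<dots> = {trace_dual (sl2_point x h y) | x h y. P x h y}"
    by blast
  finally show ?thesis
    by (simp only: trace_dual_sl2_point)
qed

lemma Omega_eq_image: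
  "Omega1 l = trace_dual ` {A. sl2_det A = - l\<^sup>2}"
  "Omega2_upper = trace_dual ` {A. sl2_det A = 0 \<and> Y_coord A > 0}"
  "Omega2_lower = trace_dual ` {A. sl2_det A = 0 \<and> Y_coord A < 0}"
  "Omega3_upper l = trace_dual ` {A. sl2_det A = l\<^sup>2 \<and> Y_coord A > 0}"
  "Omega3_lower l = trace_dual ` {A. sl2_det A = l\<^sup>2 \<and> Y_coord A < 0}"
  unfolding Omega1_def Omega2_upper_def Omega2_lower_def Omega3_upper_def Omega3_lower_def
  by (rule dual_point_set_eq_image; auto simp: sl2_det_sl2_point Y_coord_sl2_point)+


section \<open>The quadratic form of a traceless matrix\<close>

definition wedge :: "real^2 \<Rightarrow> real^2 \<Rightarrow> real"
  where "wedge u v = u $ 1 * v $ 2 - u $ 2 * v $ 1"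

definition quad :: "sl2 \<Rightarrow> real^2 \<Rightarrow> real"
  where "quad A v = wedge v (mat_of_sl2 A *v v)"

lemma wedge_mult: "wedge (g *v u) (g *v v) = det g * wedge u v"
  by (simp add: wedge_def det_2 matrix_vector_mult_def sum_2 algebra_simps)

lemma quad_entries:
  "quad A v = mat_of_sl2 A $ 2 $ 1 * (v $ 1)\<^sup>2 - 2 * mat_of_sl2 A $ 1 $ 1 * v $ 1 * v $ 2
    - mat_of_sl2 A $ 1 $ 2 * (v $ 2)\<^sup>2"
  by (simp add: quad_def wedge_def matrix_vector_mult_def sum_2 mat_of_sl2_22 power2_eq_square
      algebra_simps)

lemma quad_scaleR: "quad A (c *\<^sub>R v) = c\<^sup>2 * quad A v"
  by (simp add: quad_entries power2_eq_square algebra_simps)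

lemma quad_zero: "quad 0 v = 0"
  by (simp add: quad_entries)

lemma mat_of_Ad_intertwines:
  "g \<in> carrier SL2 \<Longrightarrow> mat_of_sl2 (Ad g A) ** g = g ** mat_of_sl2 A"
  by (simp add: mat_of_Ad SL2_matrix_inv flip: matrix_mul_assoc)

lemma Ad_eqI:
  assumes g: "g \<in> carrier SL2" and "mat_of_sl2 B ** g = g ** mat_of_sl2 A"
  shows "Ad g A = B"
proof -
  have "mat_of_sl2 (Ad g A) = mat_of_sl2 B ** g ** matrix_inv g"
    using assms by (simp add: mat_of_Ad)
  also have "\<dots> = mat_of_sl2 B"
    by (simp add: SL2_matrix_inv[OF g] flip: matrix_mul_assoc)
  finally show ?thesis
    by (simp add: mat_of_sl2_inject)
qed

lemma sl2_det_Ad: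
  assumes g: "g \<in> carrier SL2"
  shows "sl2_det (Ad g A) = sl2_det A"
  using arg_cong[OF mat_of_Ad_intertwines[OF g, of A], of det] g by (simp add: det_mul SL2_def)

lemma quad_Ad:
  assumes g: "g \<in> carrier SL2"
  shows "quad (Ad g A) (g *v v) = quad A v"
proof -
  have "mat_of_sl2 (Ad g A) *v (g *v v) = g *v (mat_of_sl2 A *v v)"
    by (simp add: matrix_vector_mul_assoc mat_of_Ad_intertwines[OF g])
  then show ?thesis
    using g by (simp add: quad_def wedge_mult SL2_def)
qed

text \<open>The matrix of a traceless \<open>A\<close> in the basis \<open>v, s A v\<close>, when \<open>s\<^sup>2 = 1\<close> and \<open>det A = d\<close>.\<close>

definition normal_form :: "real \<Rightarrow> real \<Rightarrow> sl2"
  where "normal_form s d = Abs_sl2 (vector [vector [0, - s * d], vector [s, 0]])"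

lemma mat_of_normal_form:
  "mat_of_sl2 (normal_form s d) = vector [vector [0, - s * d], vector [s, 0]]"
  by (simp add: normal_form_def mat_of_Abs_sl2 trace_def sum_2)

text \<open>
  The conjugating matrix has columns \<open>v\<close> and \<open>s A v\<close>; its determinant is \<open>s q(v) = s\<^sup>2 = 1\<close>.
\<close>

lemma Ad_normal_form:
  assumes "quad A v = s" "s\<^sup>2 = 1"
  obtains g where "g \<in> carrier SL2" "Ad g (normal_form s (sl2_det A)) = A"
proof -
  let ?a = "mat_of_sl2 A"
  define w where "w = ?a *v v"
  define g :: "real^2^2" where "g = vector [vector [v $ 1, s * w $ 1], vector [v $ 2, s * w $ 2]]"
  have ss: "s * s = 1"
    using assms(2) by (simp add: power2_eq_square)
  have "det g = s * quad A v"
    by (simp add: g_def det_2 quad_def wedge_def w_def algebra_simps)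
  then have g: "g \<in> carrier SL2"
    using assms(1) ss by (simp add: SL2_def)
  have ss': "s * (s * r) = r" for r
    using ss by (simp flip: mult.assoc)
  have "?a ** g = g ** mat_of_sl2 (normal_form s (sl2_det A))"
    by (simp add: vec_eq_iff forall_2 matrix_matrix_mult_def sum_2 g_def mat_of_normal_form
        w_def matrix_vector_mult_def mat_of_sl2_22 sl2_det_entries power2_eq_square ss'
        algebra_simps)
  then show thesis
    using that g Ad_eqI by blast
qed

text \<open>
  Rescaling \<open>u\<close> and \<open>v\<close> makes both values equal to the same \<open>s = \<plusminus>1\<close>, so \<open>A\<close> and \<open>B\<close> share a normal
  form.
\<close>

lemma SL2_conjugate_if_same_sign:
  assumes det: "sl2_det A = sl2_det B" and sign: "quad A u * quad B v > 0"
  shows "B \<in> Ad_orbit A"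
proof -
  define s where "s = sgn (quad A u)"
  have sB: "s = sgn (quad B v)" and nz: "quad A u \<noteq> 0" "quad B v \<noteq> 0"
    using sign by (auto simp: s_def zero_less_mult_iff)
  have s2: "s\<^sup>2 = 1"
    using nz by (simp add: s_def sgn_if)
  have scale: "quad C ((1 / sqrt \<bar>quad C w\<bar>) *\<^sub>R w) = sgn (quad C w)" if "quad C w \<noteq> 0" for C w
    using that by (auto simp: quad_scaleR power_divide sgn_if)
  obtain g where g: "g \<in> carrier SL2" "Ad g (normal_form s (sl2_det A)) = A"
    using Ad_normal_form[OF scale[OF nz(1)]] s2 unfolding s_def by blast
  obtain h where h: "h \<in> carrier SL2" "Ad h (normal_form s (sl2_det A)) = B"
    using Ad_normal_form[OF scale[OF nz(2)]] s2 unfolding sB det by blast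
  interpret G: group SL2
    by (rule group_SL2)
  let ?k = "h \<otimes>\<^bsub>SL2\<^esub> inv\<^bsub>SL2\<^esub> g"
  have k: "?k \<in> carrier SL2"
    using g(1) h(1) by simp
  have "Ad ?k A = Ad (?k \<otimes>\<^bsub>SL2\<^esub> g) (normal_form s (sl2_det A))"
    using Ad_mult[OF k g(1)] g(2) by simp
  also have "\<dots> = B"
    using g(1) h by (simp add: G.m_assoc)
  finally show ?thesis
    using k unfolding Ad_orbit_def by blast
qed


section \<open>Orbits of the adjoint action\<close>

text \<open>
  A nonzero square coefficient is itself a value of \<open>q\<close>, and completing the square in the variable
  that it belongs to exhibits a value of the opposite sign, since the other diagonal entry of the
  reduced form is \<open>det A < 0\<close> divided by this coefficient. If both square coefficients vanish, \<open>q\<close> is a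
  nonzero multiple of \<open>v\<^sub>1 v\<^sub>2\<close>.
\<close>

lemma quad_indefinite:
  assumes "sl2_det A < 0"
  obtains v where "quad A v > 0"
proof -
  define h p q where "h = mat_of_sl2 A $ 1 $ 1" and "p = mat_of_sl2 A $ 1 $ 2"
    and "q = mat_of_sl2 A $ 2 $ 1"
  have Q: "quad A (vector [a, b]) = q * a\<^sup>2 - 2 * h * a * b - p * b\<^sup>2" for a b
    by (simp add: quad_entries h_def p_def q_def)
  have D: "h\<^sup>2 + p * q > 0"
    using assms by (simp add: sl2_det_entries h_def p_def q_def)
  consider "q > 0" | "q < 0" | "p < 0" | "p > 0" | "p = 0" "q = 0"
    by linarith
  then have "\<exists>a b. quad A (vector [a, b]) > 0"
  proof cases
    case 1
    then show ?thesis
      by (intro exI[of _ 1] exI[of _ 0]) (simp add: Q)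
  next
    case 2
    have "quad A (vector [h, q]) = - q * (h\<^sup>2 + p * q)"
      by (simp add: Q power2_eq_square algebra_simps)
    then show ?thesis
      using 2 D by (metis mult_pos_pos neg_0_less_iff_less)
  next
    case 3
    then show ?thesis
      by (intro exI[of _ 0] exI[of _ 1]) (simp add: Q)
  next
    case 4
    have "quad A (vector [p, - h]) = p * (h\<^sup>2 + p * q)"
      by (simp add: Q power2_eq_square algebra_simps)
    then show ?thesis
      using 4 D by (metis mult_pos_pos)
  next
    case 5
    then have "quad A (vector [- h, 1]) > 0"
      using D by (simp add: Q power2_eq_square)
    then show ?thesis
      by blast
  qed
  then show thesis
    using that by blast
qed

text \<open>
  Either square coefficient times \<open>q(v)\<close> is the sum of a square and of \<open>det A\<close> times a square; adding
  these two identities gives the one below, since the square coefficients of \<open>q\<close> add up to \<open>-2 y\<close>.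
\<close>

lemma quad_semidefinite:
  assumes "sl2_det A \<ge> 0"
  shows "Y_coord A * quad A v \<le> 0"
proof -
  define h p q where "h = mat_of_sl2 A $ 1 $ 1" and "p = mat_of_sl2 A $ 1 $ 2"
    and "q = mat_of_sl2 A $ 2 $ 1"
  have "- 2 * (Y_coord A * quad A v)
      = (q * v $ 1 - h * v $ 2)\<^sup>2 + (p * v $ 2 + h * v $ 1)\<^sup>2
        + sl2_det A * ((v $ 1)\<^sup>2 + (v $ 2)\<^sup>2)"
    by (simp add: Y_coord_def quad_entries sl2_det_entries h_def p_def q_def power2_eq_square
        field_simps)
  also have "\<dots> \<ge> 0"
    using assms by simp
  finally show ?thesis
    by simp
qed

text \<open>The trace \<open>q(e\<^sub>1) + q(e\<^sub>2) = -2 y\<close> shows that one of the two basis vectors will do.\<close>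

lemma quad_attains_sign:
  assumes "Y_coord A \<noteq> 0"
  obtains v where "Y_coord A * quad A v < 0"
proof -
  have "Y_coord A * quad A (vector [1, 0]) + Y_coord A * quad A (vector [0, 1])
      = - 2 * (Y_coord A)\<^sup>2"
    by (simp add: quad_entries Y_coord_def power2_eq_square field_simps)
  also have "\<dots> < 0"
    using assms by simp
  finally show thesis
    using that by (metis add_nonneg_nonneg not_le)
qed

lemma eq_zero_if_Y_coord_zero:
  assumes "sl2_det A \<ge> 0" "Y_coord A = 0"
  shows "A = 0"
proof -
  obtain x h y where A: "A = sl2_point x h y"
    by (rule sl2_point_cases)
  with assms have "y = 0" "x\<^sup>2 + h\<^sup>2 \<le> 0"
    by (simp_all add: sl2_det_sl2_point Y_coord_sl2_point)
  then show ?thesis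
    using A by (simp add: sum_power2_le_zero_iff sl2_point_def)
qed

lemma Ad_orbit_zero: "Ad_orbit 0 = {0}"
proof -
  have "Ad g 0 = 0" if "g \<in> carrier SL2" for g
    using linear_Ad[OF that] by (rule linear_0)
  moreover have "\<one>\<^bsub>SL2\<^esub> \<in> carrier SL2"
    using group_SL2 group.is_monoid monoid.one_closed by blast
  ultimately show ?thesis
    unfolding Ad_orbit_def by fastforce
qed

lemma Ad_orbit_det_neg:
  assumes "sl2_det A < 0"
  shows "Ad_orbit A = {B. sl2_det B = sl2_det A}"
proof
  show "Ad_orbit A \<subseteq> {B. sl2_det B = sl2_det A}"
    by (auto simp: Ad_orbit_def sl2_det_Ad)
  show "{B. sl2_det B = sl2_det A} \<subseteq> Ad_orbit A"
  proof clarify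
    fix B assume det: "sl2_det B = sl2_det A"
    obtain u v where "quad A u > 0" "quad B v > 0"
      using assms det quad_indefinite by metis
    then show "B \<in> Ad_orbit A"
      using det by (intro SL2_conjugate_if_same_sign[of A B u v]) auto
  qed
qed

text \<open>
  A vector \<open>u\<close> at which the form of \<open>A\<close> is nonzero is carried along by \<open>g\<close>, so the semidefinite forms
  of \<open>A\<close> and of a conjugate \<open>B\<close> have the same sign, and this sign determines that of \<open>y\<close>. Conversely,
  equal signs of \<open>y\<close> provide values of a common sign.
\<close>

lemma Ad_orbit_det_nonneg:
  assumes det: "sl2_det A \<ge> 0" and Y: "Y_coord A \<noteq> 0"
  shows "Ad_orbit A = {B. sl2_det B = sl2_det A \<and> Y_coord A * Y_coord B > 0}"
proof
  obtain u where u: "Y_coord A * quad A u < 0"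
    using Y by (rule quad_attains_sign)
  show "Ad_orbit A \<subseteq> {B. sl2_det B = sl2_det A \<and> Y_coord A * Y_coord B > 0}"
  proof clarify
    fix B assume "B \<in> Ad_orbit A"
    then obtain g where g: "g \<in> carrier SL2" "B = Ad g A"
      by (auto simp: Ad_orbit_def)
    then have detB: "sl2_det B = sl2_det A" and qB: "quad B (g *v u) = quad A u"
      by (simp_all add: sl2_det_Ad quad_Ad)
    have "B \<noteq> 0"
      using qB u by (auto simp: quad_zero)
    then have "Y_coord B \<noteq> 0"
      using eq_zero_if_Y_coord_zero detB det by auto
    moreover have "Y_coord B * quad A u \<le> 0"
      using quad_semidefinite[of B "g *v u"] detB det qB by simp
    ultimately have "Y_coord A * Y_coord B > 0"
      using u by (auto simp: mult_less_0_iff mult_le_0_iff zero_less_mult_iff)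
    then show "sl2_det B = sl2_det A \<and> Y_coord A * Y_coord B > 0"
      using detB by simp
  qed
  show "{B. sl2_det B = sl2_det A \<and> Y_coord A * Y_coord B > 0} \<subseteq> Ad_orbit A"
  proof clarify
    fix B assume detB: "sl2_det B = sl2_det A" and AB: "0 < Y_coord A * Y_coord B"
    then have "Y_coord B \<noteq> 0"
      by auto
    then obtain v where v: "Y_coord B * quad B v < 0"
      by (rule quad_attains_sign)
    have "quad A u * quad B v > 0"
      using u v AB by (auto simp: mult_less_0_iff zero_less_mult_iff)
    then show "B \<in> Ad_orbit A"
      using detB by (intro SL2_conjugate_if_same_sign) auto
  qed
qed


section \<open>The coadjoint orbits\<close>

theorem theorem2p2:
  fixes \<Omega> :: "(sl2 \<Rightarrow> real) set"
  assumes "\<Omega> \<in> coadjoint_orbits"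
  shows "(\<exists>l::real. l \<noteq> 0 \<and> \<Omega> = Omega1 l)
    \<or> \<Omega> = Omega2_upper
    \<or> \<Omega> = Omega2_lower
    \<or> \<Omega> = Omega2_zero
    \<or> (\<exists>l::real. l \<noteq> 0 \<and> \<Omega> = Omega3_upper l)
    \<or> (\<exists>l::real. l \<noteq> 0 \<and> \<Omega> = Omega3_lower l)"
proof -
  obtain A where \<Omega>: "\<Omega> = trace_dual ` Ad_orbit A"
    using assms by (rule coadjoint_orbit_eq_image)
  define l where "l = sqrt \<bar>sl2_det A\<bar>"
  have l: "l\<^sup>2 = \<bar>sl2_det A\<bar>" "l = 0 \<longleftrightarrow> sl2_det A = 0"
    by (simp_all add: l_def)
  consider "sl2_det A < 0" | "sl2_det A \<ge> 0" "Y_coord A = 0"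
    | "sl2_det A \<ge> 0" "Y_coord A > 0" | "sl2_det A \<ge> 0" "Y_coord A < 0"
    by linarith
  then show ?thesis
  proof cases
    case 1
    then have "\<Omega> = Omega1 l" "l \<noteq> 0"
      using l by (simp_all add: \<Omega> Ad_orbit_det_neg Omega_eq_image)
    then show ?thesis
      by blast
  next
    case 2
    then have "A = 0"
      by (rule eq_zero_if_Y_coord_zero)
    then have "\<Omega> = {trace_dual 0}"
      by (simp add: \<Omega> Ad_orbit_zero)
    also have "trace_dual 0 = (\<lambda>Z. 0)"
      by (rule ext) (simp add: trace_dual_def trace_def)
    finally show ?thesis
      by (simp add: Omega2_zero_def)
  next
    case 3
    then have "\<Omega> = trace_dual ` {B. sl2_det B = sl2_det A \<and> Y_coord B > 0}"
      by (simp add: \<Omega> Ad_orbit_det_nonneg zero_less_mult_iff)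
    then have "\<Omega> = Omega3_upper l" "sl2_det A = 0 \<Longrightarrow> \<Omega> = Omega2_upper"
      using 3 l by (simp_all add: Omega_eq_image)
    then show ?thesis
      using l(2) by blast
  next
    case 4
    then have "\<Omega> = trace_dual ` {B. sl2_det B = sl2_det A \<and> Y_coord B < 0}"
      by (simp add: \<Omega> Ad_orbit_det_nonneg zero_less_mult_iff)
    then have "\<Omega> = Omega3_lower l" "sl2_det A = 0 \<Longrightarrow> \<Omega> = Omega2_lower"
      using 4 l by (simp_all add: Omega_eq_image)
    then show ?thesis
      using l(2) by blast
  qed
qed

end
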